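(* Let $p\geq 3$ be an odd prime, let $n\geq 2$ be an integer, and let $\zeta_p:\{\xi\in\mathbb{Z}:\gcd(\xi,p)=1\}\to\{0,1\}$ be a function such that (1) if $\gcd(\theta_1,p)=\gcd(\theta_2,p)=1$ and $\theta_1\equiv\theta_2\pmod p$, then $\zeta_p(\theta_1)=\zeta_p(\theta_2)$; and (2) the sets $A_i=\{a:\zeta_p(a)=i,\ 1\leq a\leq p-1\}$, $i=0,1$, satisfy $|A_0|=|A_1|=\frac{p-1}{2}$. Let $G$ be a simple connected bipartite graph of order $n$, and let $S=\{1,2,\ldots,np\}$. Then the tensor product graph $K_p\times G$ is an arithmetic cordial graph modulo $p$ under $\langle S,\zeta_p,+\rangle$, where $+$ is ordinary addition of integers.
   Context: $K_p$ is the complete graph on $p$ vertices. A bipartite graph is one whose vertex set can be partitioned into two nonempty subsets such that every edge has one end in each. Tensor product graph: $G\times H$ has vertex set $V(G)\times V(H)$ and edge set $\{(a_1,b_1)(a_2,b_2):a_1a_2\in E(G)\text{ and }b_1b_2\in E(H)\}$. Arithmetic cordial graph: let $\eta$ be a positive integer, $S\subseteq\mathbb{Z}$, $\star:S\times S\to\mathbb{Z}$ a binary function, and $\zeta_\eta:\{\xi\in\mathbb{Z}:\gcd(\xi,\eta)=1\}\to\{0,1\}$ a function. The triple $\langle S,\zeta_\eta,\star\rangle$ is called an arithmetic structure. For a simple connected graph $\Gamma$ of order $N$, a bijection $f:V(\Gamma)\to S$ (where $|S|=N$) is an arithmetic cordial labeling modulo $\eta$ under $\langle S,\zeta_\eta,\star\rangle$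 if the induced function $f_\eta^*:E(\Gamma)\to\{0,1\}$, defined by $f_\eta^*(ab)=0$ if $\gcd(f(a)\star f(b),\eta)\neq 1$ or $\zeta_\eta(f(a)\star f(b))=0$, and $f_\eta^*(ab)=1$ if $\gcd(f(a)\star f(b),\eta)=1$ and $\zeta_\eta(f(a)\star f(b))=1$, satisfies $|e_{f_\eta^*}(0)-e_{f_\eta^*}(1)|\leq 1$, where $e_{f_\eta^*}(i)$ is the number of edges with label $i$. A graph admitting such a labeling is an arithmetic cordial graph modulo $\eta$ under $\langle S,\zeta_\eta,\star\rangle$. *)

theory Defs
  imports "HOL-Number_Theory.Cong" "HOL-Library.FuncSet"
begin

record 'a ugraph =
  verts :: "'a set"
  edges :: "'a set set"

definition simple_graph :: "'a ugraph \<Rightarrow> bool" where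
  "simple_graph G \<longleftrightarrow> finite (verts G) \<and> (\<forall>e\<in>edges G. e \<subseteq> verts G \<and> card e = 2)"

definition order :: "'a ugraph \<Rightarrow> nat" where
  "order G = card (verts G)"

definition adj_rel :: "'a ugraph \<Rightarrow> ('a \<times> 'a) set" where
  "adj_rel G = {(a, b). {a, b} \<in> edges G}"

definition connected_graph :: "'a ugraph \<Rightarrow> bool" where
  "connected_graph G \<longleftrightarrow> verts G \<noteq> {} \<and>
     (\<forall>u\<in>verts G. \<forall>v\<in>verts G. (u, v) \<in> (adj_rel G)\<^sup>*)"

definition bipartite_graph :: "'a ugraph \<Rightarrow> bool" where
  "bipartite_graph G \<longleftrightarrow>
     (\<exists>X Y. X \<noteq> {} \<and> Y \<noteq> {} \<and> X \<inter> Y = {} \<and> X \<union> Y = verts G \<and>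
        (\<forall>e\<in>edges G. \<exists>x\<in>X. \<exists>y\<in>Y. e = {x, y}))"

definition complete_graph :: "nat \<Rightarrow> nat ugraph" where
  "complete_graph p =
     \<lparr>verts = {0..<p}, edges = {{a, b} | a b. a < p \<and> b < p \<and> a \<noteq> b}\<rparr>"

definition tensor_product :: "'a ugraph \<Rightarrow> 'b ugraph \<Rightarrow> ('a \<times> 'b) ugraph" where
  "tensor_product G H =
     \<lparr>verts = verts G \<times> verts H,
      edges = {{(a1, b1), (a2, b2)} | a1 b1 a2 b2. {a1, a2} \<in> edges G \<and> {b1, b2} \<in> edges H}\<rparr>"

text \<open>
  A function on the integers coprime to \<open>\<eta>\<close> is represented by a total function on the
  integers, whose values outside that domain are never inspected. The binary operation on
  \<open>S\<close> is likewise represented by a total operation.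
\<close>

definition arithmetic_structure ::
    "nat \<Rightarrow> int set \<Rightarrow> (int \<Rightarrow> nat) \<Rightarrow> (int \<Rightarrow> int \<Rightarrow> int) \<Rightarrow> bool" where
  "arithmetic_structure \<eta> S \<zeta> star \<longleftrightarrow>
     \<eta> > 0 \<and> \<zeta> \<in> {\<xi>. gcd \<xi> (int \<eta>) = 1} \<rightarrow> {0, 1}"

definition arith_label :: "nat \<Rightarrow> (int \<Rightarrow> nat) \<Rightarrow> int \<Rightarrow> nat" where
  "arith_label \<eta> \<zeta> x = (if gcd x (int \<eta>) \<noteq> 1 \<or> \<zeta> x = 0 then 0 else 1)"

text \<open>
  Edges are unordered, so the label of an edge \<open>ab\<close> is well defined only if
  \<open>f a \<star> f b\<close> and \<open>f b \<star> f a\<close> receive the same label. The induced edge labeling is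
  therefore specified by a predicate; at most one function on the edges satisfies it, and
  one exists whenever the operation is commutative.
\<close>

definition induced_edge_labeling ::
    "nat \<Rightarrow> (int \<Rightarrow> nat) \<Rightarrow> (int \<Rightarrow> int \<Rightarrow> int) \<Rightarrow> 'a ugraph \<Rightarrow> ('a \<Rightarrow> int) \<Rightarrow> ('a set \<Rightarrow> nat) \<Rightarrow> bool"
  where
  "induced_edge_labeling \<eta> \<zeta> star G f g \<longleftrightarrow>
     (\<forall>a b. {a, b} \<in> edges G \<longrightarrow> g {a, b} = arith_label \<eta> \<zeta> (star (f a) (f b)))"

definition edge_count :: "'a ugraph \<Rightarrow> ('a set \<Rightarrow> nat) \<Rightarrow> nat \<Rightarrow> nat" where
  "edge_count G g i = card {e \<in> edges G. g e = i}"

definition arithmetic_cordial_labeling ::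
    "nat \<Rightarrow> int set \<Rightarrow> (int \<Rightarrow> nat) \<Rightarrow> (int \<Rightarrow> int \<Rightarrow> int) \<Rightarrow> 'a ugraph \<Rightarrow> ('a \<Rightarrow> int) \<Rightarrow> bool" where
  "arithmetic_cordial_labeling \<eta> S \<zeta> star G f \<longleftrightarrow>
     bij_betw f (verts G) S \<and>
     (\<exists>g. induced_edge_labeling \<eta> \<zeta> star G f g \<and>
          \<bar>int (edge_count G g 0) - int (edge_count G g 1)\<bar> \<le> 1)"

definition arithmetic_cordial_graph ::
    "nat \<Rightarrow> int set \<Rightarrow> (int \<Rightarrow> nat) \<Rightarrow> (int \<Rightarrow> int \<Rightarrow> int) \<Rightarrow> 'a ugraph \<Rightarrow> bool" where
  "arithmetic_cordial_graph \<eta> S \<zeta> star G \<longleftrightarrow>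
     arithmetic_structure \<eta> S \<zeta> star \<and> simple_graph G \<and> connected_graph G \<and>
     (\<exists>f. arithmetic_cordial_labeling \<eta> S \<zeta> star G f)"

end

theory Submission
  imports Defs
begin

text \<open>
  Let \<open>X\<close> be one side of the bipartition of \<open>G\<close>. Give the copy \<open>{0..<p} \<times> {v}\<close> of the vertices
  of \<open>K_p\<close> a block of \<open>p\<close> consecutive integers, arranged inside the block so that \<open>(i, v)\<close> receives
  a label congruent to \<open>i + 1\<close> modulo \<open>p\<close> if \<open>v \<in> X\<close>, and to \<open>-(i + 1)\<close> otherwise. An edge of
  \<open>K_p \<times> G\<close> above an edge \<open>{x, y}\<close> of \<open>G\<close> with \<open>x \<in> X\<close> is \<open>{(i, x), (j, y)}\<close> with \<open>i \<noteq> j\<close>, and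
  its label sum is congruent to \<open>i - j\<close> (\<open>block_label_sum_cong\<close>). As \<open>(i, j)\<close> ranges over the ordered pairs of distinct
  elements, every nonzero residue arises as \<open>i - j\<close> exactly \<open>p\<close> times
  (\<open>card_pairs_with_difference_in\<close>). Since \<open>\<zeta>\<close> takes each of its
  values on half of the nonzero residues, above each edge of \<open>G\<close> there are equally many edges
  labelled \<open>0\<close> and \<open>1\<close>; by \<open>card_edges_tensor_complete_bipartite\<close> the two global counts are
  therefore equal.

  Cordiality also asks for the product to be simple and connected. Connectedness holds because
  \<open>K_p\<close> contains a triangle: walks in \<open>G\<close> lift to the product with arbitrary prescribed first
  coordinates at both ends (\<open>connected_graph_tensor_complete\<close>).
\<close>

section \<open>The tensor product with a complete graph\<close>

lemma edge_complete_graph: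
  "{a, b} \<in> edges (complete_graph p) \<longleftrightarrow> a < p \<and> b < p \<and> a \<noteq> b"
  by (auto simp: complete_graph_def doubleton_eq_iff)

lemma verts_tensor_complete:
  "verts (tensor_product (complete_graph p) G) = {0..<p} \<times> verts G"
  by (simp add: tensor_product_def complete_graph_def)

lemma edges_tensor_complete:
  "edges (tensor_product (complete_graph p) G) =
     {{(i, u), (j, v)} | i u j v. i < p \<and> j < p \<and> i \<noteq> j \<and> {u, v} \<in> edges G}"
  by (auto simp: tensor_product_def edge_complete_graph)

lemma simple_graph_tensor_complete:
  assumes "simple_graph G"
  shows "simple_graph (tensor_product (complete_graph p) G)"
proof -
  have "e \<subseteq> {0..<p} \<times> verts G \<and> card e = 2"
    if e: "e \<in> edges (tensor_product (complete_graph p) G)" for e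
  proof -
    obtain i u j v where "e = {(i, u), (j, v)}" "i < p" "j < p" "i \<noteq> j" "{u, v} \<in> edges G"
      using e unfolding edges_tensor_complete by blast
    moreover from this have "{u, v} \<subseteq> verts G"
      using assms by (metis simple_graph_def)
    ultimately show ?thesis by auto
  qed
  then show ?thesis
    using assms by (simp add: simple_graph_def verts_tensor_complete)
qed

text \<open>
  If \<open>a \<noteq> b\<close> the two vertices are adjacent. If \<open>a = b\<close>, walk around a triangle of the complete
  graph in three steps, alternating between \<open>u\<close> and \<open>v\<close>; this needs three vertices.
\<close>

lemma tensor_complete_reaches_above_edge:
  assumes "p \<ge> 3" and "a < p" and "b < p" and "{u, v} \<in> edges G"
  shows "((a, u), (b, v)) \<in> (adj_rel (tensor_product (complete_graph p) G))\<^sup>*"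
proof -
  let ?R = "adj_rel (tensor_product (complete_graph p) G)"
  have step: "((i, s), (j, t)) \<in> ?R"
    if "i < p" "j < p" "i \<noteq> j" "{s, t} \<in> edges G" for i j s t
    using that by (auto simp: adj_rel_def edges_tensor_complete)
  show ?thesis
  proof (cases "a = b")
    case False
    then show ?thesis using step assms by blast
  next
    case True
    have "\<exists>c d. c < p \<and> d < p \<and> c \<noteq> a \<and> d \<noteq> a \<and> c \<noteq> d"
    proof -
      consider "a = 0" | "a = 1" | "a \<ge> 2" by linarith
      then show ?thesis
      proof cases
        case 1 then show ?thesis using assms by (intro exI[of _ 1] exI[of _ 2]) auto
      next
        case 2 then show ?thesis using assms by (intro exI[of _ 0] exI[of _ 2]) auto
      next
        case 3 then show ?thesis using assms by (intro exI[of _ 0] exI[of _ 1]) auto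
      qed
    qed
    then obtain c d where cd: "c < p" "d < p" "c \<noteq> a" "d \<noteq> a" "c \<noteq> d" by blast
    have "{v, u} \<in> edges G" using assms(4) by (simp add: insert_commute)
    then have "((a, u), (c, v)) \<in> ?R" "((c, v), (d, u)) \<in> ?R" "((d, u), (b, v)) \<in> ?R"
      using step cd assms True by metis+
    then show ?thesis by (meson converse_rtrancl_into_rtrancl rtrancl.rtrancl_refl)
  qed
qed

text \<open>
  Lifting a walk edge by edge handles nontrivial walks only, so a vertex of \<open>G\<close> is joined to itself
  by a closed walk through some other vertex.
\<close>

lemma connected_graph_tensor_complete:
  assumes "p \<ge> 3" and G: "connected_graph G" and "card (verts G) \<ge> 2"
  shows "connected_graph (tensor_product (complete_graph p) G)"
proof -
  let ?R = "adj_rel (tensor_product (complete_graph p) G)"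
  have lift: "((a, u), (b, v)) \<in> ?R\<^sup>*" if "(u, v) \<in> (adj_rel G)\<^sup>+" "a < p" "b < p" for u v a b
    using that
  proof (induction arbitrary: b rule: trancl_induct)
    case (base v)
    then show ?case
      using tensor_complete_reaches_above_edge[OF \<open>p \<ge> 3\<close>] by (auto simp: adj_rel_def)
  next
    case (step v w)
    have "((b, v), (b, w)) \<in> ?R\<^sup>*"
      using tensor_complete_reaches_above_edge[OF \<open>p \<ge> 3\<close>] step by (auto simp: adj_rel_def)
    then show ?case using step.IH step.prems by (meson rtrancl_trans)
  qed
  have walk: "(u, v) \<in> (adj_rel G)\<^sup>+" if "u \<in> verts G" "v \<in> verts G" for u v
  proof -
    have distinct: "(s, t) \<in> (adj_rel G)\<^sup>+" if "s \<in> verts G" "t \<in> verts G" "s \<noteq> t" for s t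
      using G that by (auto simp: connected_graph_def dest: rtranclD)
    show ?thesis
    proof (cases "u = v")
      case True
      have "\<not> verts G \<subseteq> {u}"
        using assms(3) card_mono[of "{u}" "verts G"] by auto
      then obtain w where "w \<in> verts G" "w \<noteq> u" by blast
      then show ?thesis using True distinct that by (metis trancl_trans)
    qed (use distinct that in blast)
  qed
  have "verts G \<noteq> {}" using G by (simp add: connected_graph_def)
  then show ?thesis
    using lift walk \<open>p \<ge> 3\<close> by (auto simp: connected_graph_def verts_tensor_complete)
qed

section \<open>Labelling by blocks of consecutive integers\<close>

text \<open>
  The offset \<open>1 + (- 2 - i) mod p\<close> is the representative of \<open>- (i + 1)\<close> in \<open>{1..p}\<close>.
\<close>

definition block_label :: "nat \<Rightarrow> 'a set \<Rightarrow> ('a \<Rightarrow> nat) \<Rightarrow> nat \<times> 'a \<Rightarrow> int" where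
  "block_label p X h =
     (\<lambda>(i, v). int p * int (h v) + (1 + (if v \<in> X then int i else (- 2 - int i) mod int p)))"

lemma block_label_sum_cong:
  assumes "x \<in> X" and "y \<notin> X"
  shows "[block_label p X h (i, x) + block_label p X h (j, y) = int i - int j] (mod int p)"
proof -
  have "(block_label p X h (i, x) + block_label p X h (j, y)) mod int p =
      (int p * int (h x) + int p * int (h y) + (int i + 2 + (- 2 - int j) mod int p)) mod int p"
    using assms by (simp add: block_label_def algebra_simps)
  also have "\<dots> = (int i + 2 + (- 2 - int j) mod int p) mod int p"
    by (metis distrib_left mod_mult_self4)
  also have "\<dots> = (int i - int j) mod int p"
    by (simp add: mod_simps)
  finally show ?thesis by (simp add: cong_def)
qed

lemma bij_betw_block_label:
  assumes h: "bij_betw h V {0..<n}" and "p > 0"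
  shows "bij_betw (block_label p X h) ({0..<p} \<times> V) {1..int (n * p)}"
proof -
  define k where "k v i = (if v \<in> X then int i else (- 2 - int i) mod int p)" for v i
  have label: "block_label p X h (i, v) = int p * int (h v) + (1 + k v i)" for i v
    by (simp add: block_label_def k_def)
  have k: "0 \<le> k v i" "k v i < int p" if "i < p" for v i
    using that by (auto simp: k_def)
  have k_inj: "i = j" if "k v i = k v j" "i < p" "j < p" for v i j
  proof (cases "v \<in> X")
    case False
    then have "[- 2 - int i = - 2 - int j] (mod int p)"
      using that by (simp add: k_def cong_def)
    then have "[int i = int j] (mod int p)"
      using cong_diff[OF cong_refl[of "- 2"]] by fastforce
    then show ?thesis using that by (simp add: cong_def)
  qed (use that in \<open>simp add: k_def\<close>)
  have inj: "inj_on (block_label p X h) ({0..<p} \<times> V)"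
  proof (rule inj_onI, clarify)
    fix i u j v
    assume *: "i \<in> {0..<p}" "j \<in> {0..<p}" "u \<in> V" "v \<in> V"
      and "block_label p X h (i, u) = block_label p X h (j, v)"
    then have eq: "int p * int (h u) + k u i = int p * int (h v) + k v j"
      by (simp add: label)
    have "int (h u) = int (h v)"
      using arg_cong[OF eq, of "\<lambda>t. t div int p"] k * \<open>p > 0\<close> by simp
    then have "u = v" using h * by (auto simp: bij_betw_def dest: inj_onD)
    then show "i = j \<and> u = v" using eq k_inj * by auto
  qed
  have "block_label p X h ` ({0..<p} \<times> V) \<subseteq> {1..int (n * p)}"
  proof (clarify)
    fix i v assume *: "i \<in> {0..<p}" "v \<in> V"
    then have "h v < n" using h by (auto simp: bij_betw_def)
    then have "int p * (int (h v) + 1) \<le> int p * int n"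
      by (intro mult_left_mono) auto
    then show "block_label p X h (i, v) \<in> {1..int (n * p)}"
      using k[of i v] * by (simp add: label algebra_simps)
  qed
  moreover have "card (block_label p X h ` ({0..<p} \<times> V)) = card {1..int (n * p)}"
    using inj bij_betw_same_card[OF h] by (simp add: card_image card_cartesian_product nat_mult_distrib)
  ultimately have "block_label p X h ` ({0..<p} \<times> V) = {1..int (n * p)}"
    by (intro card_subset_eq) auto
  with inj show ?thesis by (simp add: bij_betw_def)
qed

section \<open>Counting edges by label\<close>

text \<open>
  Given \<open>i\<close>, the index \<open>j\<close> is determined by the residue of \<open>i - j\<close>, which may be arbitrary.
\<close>

lemma card_pairs_with_difference_in:
  assumes "A \<subseteq> {0..<int p}"
  shows "card {(i, j). i < p \<and> j < p \<and> (int i - int j) mod int p \<in> A} = p * card A"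
proof -
  let ?D = "{(i, j). i < p \<and> j < p \<and> (int i - int j) mod int p \<in> A}"
  have "bij_betw (\<lambda>(i, j). (i, (int i - int j) mod int p)) ?D ({..<p} \<times> A)"
  proof (rule bij_betw_byWitness[where f' = "\<lambda>(i, d). (i, nat ((int i - d) mod int p))"])
    show "(\<lambda>(i, d). (i, nat ((int i - d) mod int p))) ` ({..<p} \<times> A) \<subseteq> ?D"
      using assms by (auto simp: nat_less_iff mod_simps)
  qed (use assms in \<open>auto simp: mod_simps\<close>)
  then have "card ?D = card ({..<p} \<times> A)" by (rule bij_betw_same_card)
  then show ?thesis by (simp add: card_cartesian_product)
qed

text \<open>
  The edges of the product above an edge \<open>{x, y}\<close> of \<open>G\<close> correspond to the ordered pairs of
  distinct indices, because the bipartition orients \<open>{x, y}\<close>. If membership in \<open>M\<close> only depends on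
  these indices, all edges of \<open>G\<close> contribute equally.
\<close>

lemma card_edges_tensor_complete_bipartite:
  assumes bip: "\<forall>e\<in>edges G. \<exists>x\<in>X. \<exists>y. y \<notin> X \<and> e = {x, y}"
    and M: "\<And>x y i j. x \<in> X \<Longrightarrow> y \<notin> X \<Longrightarrow> i < p \<Longrightarrow> j < p \<Longrightarrow> i \<noteq> j \<Longrightarrow>
              M {(i, x), (j, y)} \<longleftrightarrow> D i j"
  shows "card {e \<in> edges (tensor_product (complete_graph p) G). M e} =
     card {(x, y). x \<in> X \<and> y \<notin> X \<and> {x, y} \<in> edges G} *
     card {(i, j). i < p \<and> j < p \<and> i \<noteq> j \<and> D i j}"
proof -
  let ?O = "{(x, y). x \<in> X \<and> y \<notin> X \<and> {x, y} \<in> edges G}"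
  let ?P = "{(i, j). i < p \<and> j < p \<and> i \<noteq> j \<and> D i j}"
  let ?edge = "\<lambda>((x, y), (i, j)). {(i, x), (j, y)}"
  have "inj_on ?edge (?O \<times> ?P)"
    by (auto simp: inj_on_def doubleton_eq_iff)
  then have "card (?edge ` (?O \<times> ?P)) = card ?O * card ?P"
    by (simp only: card_image card_cartesian_product)
  moreover have "?edge ` (?O \<times> ?P) = {e \<in> edges (tensor_product (complete_graph p) G). M e}"
    (is "_ = ?E")
  proof (intro equalityI subsetI)
    fix e assume "e \<in> ?edge ` (?O \<times> ?P)"
    then obtain x y i j where e: "e = {(i, x), (j, y)}" "x \<in> X" "y \<notin> X" "{x, y} \<in> edges G"
        "i < p" "j < p" "i \<noteq> j" "D i j"
      by auto
    then have "e \<in> edges (tensor_product (complete_graph p) G)"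
      unfolding edges_tensor_complete by blast
    then show "e \<in> ?E" using M e by simp
  next
    fix e assume e: "e \<in> ?E"
    then obtain i u j v where
      uv: "e = {(i, u), (j, v)}" "i < p" "j < p" "i \<noteq> j" "{u, v} \<in> edges G"
      by (auto simp: edges_tensor_complete)
    then obtain x y where xy: "x \<in> X" "y \<notin> X" "{u, v} = {x, y}" using bip by blast
    then consider "u = x" "v = y" | "u = y" "v = x" by (auto simp: doubleton_eq_iff)
    then obtain i' j' where e': "e = {(i', x), (j', y)}" "i' < p" "j' < p" "i' \<noteq> j'"
      using uv by cases (auto simp: insert_commute)
    then have "((x, y), (i', j')) \<in> ?O \<times> ?P" using M e xy uv(5) by auto
    then show "e \<in> ?edge ` (?O \<times> ?P)" by (rule rev_image_eqI) (simp add: e'(1))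
  qed
  ultimately show ?thesis by (simp only:)
qed

lemma arith_label_eq_mod:
  assumes "prime p"
    and "\<zeta> \<in> {\<xi>. gcd \<xi> (int p) = 1} \<rightarrow> {0, 1}"
    and "\<And>\<theta>1 \<theta>2. gcd \<theta>1 (int p) = 1 \<Longrightarrow> gcd \<theta>2 (int p) = 1 \<Longrightarrow> [\<theta>1 = \<theta>2] (mod int p)
           \<Longrightarrow> \<zeta> \<theta>1 = \<zeta> \<theta>2"
    and "s mod int p \<noteq> 0"
  shows "arith_label p \<zeta> s = \<zeta> (s mod int p)"
proof -
  have "\<not> int p dvd s" using assms(4) by (simp add: dvd_eq_mod_eq_0)
  then have "coprime (int p) s" using assms(1) by (intro prime_imp_coprime) simp_all
  then have g: "gcd s (int p) = 1" by (simp add: coprime_iff_gcd_eq_1 gcd.commute)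
  then have "\<zeta> s = \<zeta> (s mod int p)"
    by (intro assms(3)) (simp_all add: cong_def gcd.commute[of _ "int p"] flip: gcd_red_int)
  moreover have "\<zeta> s \<in> {0, 1}" using g assms(2) by auto
  ultimately show ?thesis using g by (auto simp: arith_label_def)
qed

theorem theorem4p4:
  fixes p n :: nat and \<zeta> :: "int \<Rightarrow> nat" and G :: "'a ugraph" and S :: "int set"
  assumes "prime p" and "odd p" and "p \<ge> 3" and "n \<ge> 2"
    and "\<zeta> \<in> {\<xi>. gcd \<xi> (int p) = 1} \<rightarrow> {0, 1}"
    and "\<And>\<theta>1 \<theta>2. gcd \<theta>1 (int p) = 1 \<Longrightarrow> gcd \<theta>2 (int p) = 1 \<Longrightarrow> [\<theta>1 = \<theta>2] (mod int p)
           \<Longrightarrow> \<zeta> \<theta>1 = \<zeta> \<theta>2"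
    and "card {a. \<zeta> a = 0 \<and> 1 \<le> a \<and> a \<le> int p - 1} = (p - 1) div 2"
    and "card {a. \<zeta> a = 1 \<and> 1 \<le> a \<and> a \<le> int p - 1} = (p - 1) div 2"
    and "simple_graph G" and "connected_graph G" and "bipartite_graph G" and "order G = n"
    and "S = {1..int (n * p)}"
  shows "arithmetic_cordial_graph p S \<zeta> (+) (tensor_product (complete_graph p) G)"
proof -
  let ?T = "tensor_product (complete_graph p) G"
  have simple: "simple_graph ?T"
    using assms(9) by (rule simple_graph_tensor_complete)
  have connected: "connected_graph ?T"
    using assms(3,4,10,12) by (simp add: connected_graph_tensor_complete order_def)
  obtain h where h: "bij_betw h (verts G) {0..<n}"
    using assms(9,12) ex_bij_betw_finite_nat unfolding simple_graph_def order_def by blast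
  obtain X where X: "\<forall>e\<in>edges G. \<exists>x\<in>X. \<exists>y. y \<notin> X \<and> e = {x, y}"
    using assms(11) unfolding bipartite_graph_def by (metis disjoint_iff)
  define f where "f = block_label p X h"
  have bij: "bij_betw f (verts ?T) S"
    using bij_betw_block_label[OF h] assms(3,13) by (simp add: f_def verts_tensor_complete)

  \<comment> \<open>Summing over the edge as a set makes the independence of the order of its ends evident.\<close>
  define g where "g e = arith_label p \<zeta> (\<Sum>v\<in>e. f v)" for e
  have "g {u, v} = arith_label p \<zeta> (f u + f v)" if "{u, v} \<in> edges ?T" for u v
  proof -
    have "u \<noteq> v" using simple that by (force simp: simple_graph_def)
    then show ?thesis by (simp add: g_def)
  qed
  then have induced: "induced_edge_labeling p \<zeta> (+) ?T f g"
    by (simp add: induced_edge_labeling_def)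

  define A where "A c = {a. \<zeta> a = c \<and> 1 \<le> a \<and> a \<le> int p - 1}" for c
  have g_above: "g {(i, x), (j, y)} = c \<longleftrightarrow> (int i - int j) mod int p \<in> A c"
    if "x \<in> X" "y \<notin> X" "i < p" "j < p" "i \<noteq> j" for x y i j c
  proof -
    have nz: "(int i - int j) mod int p \<noteq> 0"
    proof
      assume "(int i - int j) mod int p = 0"
      then have "[int i = int j] (mod int p)"
        by (simp add: cong_iff_dvd_diff dvd_eq_mod_eq_0)
      then show False using that by (simp add: cong_def)
    qed
    have "g {(i, x), (j, y)} = arith_label p \<zeta> (f (i, x) + f (j, y))"
      using that by (simp add: g_def)
    also have "\<dots> = \<zeta> ((int i - int j) mod int p)"
    proof -
      have "(f (i, x) + f (j, y)) mod int p = (int i - int j) mod int p"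
        using block_label_sum_cong[OF that(1,2)] unfolding f_def cong_def .
      with nz show ?thesis
        using arith_label_eq_mod[OF assms(1,5,6), where s = "f (i, x) + f (j, y)"] by metis
    qed
    finally have "g {(i, x), (j, y)} = \<zeta> ((int i - int j) mod int p)" .
    moreover have "0 \<le> (int i - int j) mod int p" "(int i - int j) mod int p < int p"
      using assms(3) by simp_all
    ultimately show ?thesis using nz by (auto simp: A_def)
  qed
  have count: "edge_count ?T g c =
      card {(x, y). x \<in> X \<and> y \<notin> X \<and> {x, y} \<in> edges G} * (p * card (A c))" for c
  proof -
    have "{(i, j). i < p \<and> j < p \<and> i \<noteq> j \<and> (int i - int j) mod int p \<in> A c} =
        {(i, j). i < p \<and> j < p \<and> (int i - int j) mod int p \<in> A c}"
      by (auto simp: A_def)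
    moreover have "A c \<subseteq> {0..<int p}" by (auto simp: A_def)
    ultimately show ?thesis
      unfolding edge_count_def
      by (subst card_edges_tensor_complete_bipartite[OF X,
            where M = "\<lambda>e. g e = c" and D = "\<lambda>i j. (int i - int j) mod int p \<in> A c", OF g_above])
        (simp_all add: card_pairs_with_difference_in)
  qed
  have "edge_count ?T g 0 = edge_count ?T g 1"
    using assms(7,8) by (simp add: count A_def)
  with bij induced have "arithmetic_cordial_labeling p S \<zeta> (+) ?T f"
    by (auto simp: arithmetic_cordial_labeling_def)
  moreover have "arithmetic_structure p S \<zeta> (+)"
    using assms(3,5) by (simp add: arithmetic_structure_def)
  ultimately show ?thesis
    using simple connected by (auto simp: arithmetic_cordial_graph_def)
qed

end
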